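(* There is an absolute constant $C>0$ such that the following holds. For every integer $k\geq 1$, every $\rho\in(0,1]$, every $\varepsilon\in(0,1]$ and $\delta\in(0,1)$, and every reference distribution $\mathbf{q}$ on $[k]$, there exists a private-coin $\rho$-LDP protocol for $(k,\varepsilon,\delta)$-identity testing in which every player applies $k$-RAPPOR to its sample, using $n= C\frac{k^{3/2}}{\varepsilon^2\rho^2}\log\frac{1}{\delta}$ players.
   Context: Notation: $[k]=\{1,\dots,k\}$; $d_{TV}(\mathbf{p},\mathbf{q})=\frac12\sum_x|\mathbf{p}(x)-\mathbf{q}(x)|$. A channel $W$ from a finite set $\mathcal{X}$ to a message set $\mathcal{Y}$ (with output distribution $W(\cdot\mid x)$ on input $x$) is $\rho$-locally differentially private ($\rho$-LDP) if $W(y\mid x')\leq e^{\rho}W(y\mid x)$ for all $y\in\mathcal{Y}$, $x,x'\in\mathcal{X}$. Setting: $n$ players, player $i$ holds $X_i$, where $X_1,\dots,X_n$ are i.i.d. from an unknown distribution $\mathbf{p}$ on $[k]$. In a private-coin (non-interactive) protocol each player $i$ chooses a $\rho$-LDP channel $W_i$ (possibly depending on its own private randomness $U_i$, where $U_1,\dots,U_n$ are mutually independent and independent of the samples) and simultaneously sends to a referee the message $Y_i$ obtained by passing $X_i$ through $W_i$; the referee, who knows the protocol but not the $U_i$, applies a (possibly randomized) map to $(Y_1,\dots,Y_n)$ outputting accept or reject. Such a protocol solves $(k,\varepsilon,\delta)$-identity testing for the known reference $\mathbf{q}$ if it outputs accept with probability $>1-\delta$ whenever $\mathbf{p}=\mathbf{q}$,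 and outputs reject with probability $>1-\delta$ whenever $d_{TV}(\mathbf{p},\mathbf{q})>\varepsilon$. The $k$-RAPPOR mechanism maps $x\in[k]$ to $y\in\{0,1\}^k$ by first forming the one-hot vector $y'_j=\mathbb{1}\{x=j\}$ and then flipping each bit of $y'$ independently with probability $\frac{1}{e^{\rho/2}+1}$; it is $\rho$-LDP. *)

theory Defs
  imports "HOL-Probability.Probability"
begin

text \<open>A distribution on \<open>[k]\<close> is a \<^typ>\<open>nat pmf\<close> whose support is contained in \<open>{1..k}\<close>.\<close>

definition distributions_on :: "nat \<Rightarrow> nat pmf set" where
  "distributions_on k = {p. set_pmf p \<subseteq> {1..k}}"

definition tv_dist :: "nat \<Rightarrow> nat pmf \<Rightarrow> nat pmf \<Rightarrow> real" where
  "tv_dist k p q = 1 / 2 * (\<Sum>x\<in>{1..k}. \<bar>pmf p x - pmf q x\<bar>)"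

definition locally_private :: "real \<Rightarrow> 'x set \<Rightarrow> ('x \<Rightarrow> 'y pmf) \<Rightarrow> bool" where
  "locally_private \<rho> X W \<longleftrightarrow>
     (\<forall>y. \<forall>x\<in>X. \<forall>x'\<in>X. pmf (W x') y \<le> exp \<rho> * pmf (W x) y)"

text \<open>
  A vector in \<open>{0,1}\<^sup>k\<close> is a function \<^typ>\<open>nat \<Rightarrow> bool\<close> that is \<^const>\<open>False\<close> outside \<open>{1..k}\<close>.
\<close>

definition rappor :: "nat \<Rightarrow> real \<Rightarrow> nat \<Rightarrow> (nat \<Rightarrow> bool) pmf" where
  "rappor k \<rho> x =
     Pi_pmf {1..k} False
       (\<lambda>j. map_pmf (\<lambda>flip. if flip then \<not> (x = j) else x = j)
              (bernoulli_pmf (1 / (exp (\<rho> / 2) + 1))))"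

text \<open>
  Player \<open>i\<close> draws its private coin \<open>u\<close> from \<open>coin P i\<close> and sends its sample through the
  channel \<open>chan P i u\<close>. The referee is randomized and does not see the coins; its output
  \<^const>\<open>True\<close> means accept.
\<close>

record ('u, 'y) protocol =
  coin :: "nat \<Rightarrow> 'u pmf"
  chan :: "nat \<Rightarrow> 'u \<Rightarrow> nat \<Rightarrow> 'y pmf"
  referee :: "(nat \<Rightarrow> 'y) \<Rightarrow> bool pmf"

definition ldp_protocol :: "nat \<Rightarrow> nat \<Rightarrow> real \<Rightarrow> ('u, 'y) protocol \<Rightarrow> bool" where
  "ldp_protocol n k \<rho> P \<longleftrightarrow>
     (\<forall>i\<in>{1..n}. \<forall>u\<in>set_pmf (coin P i). locally_private \<rho> {1..k} (chan P i u))"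

definition all_use_rappor ::
    "nat \<Rightarrow> nat \<Rightarrow> real \<Rightarrow> ('u, nat \<Rightarrow> bool) protocol \<Rightarrow> bool" where
  "all_use_rappor n k \<rho> P \<longleftrightarrow>
     (\<forall>i\<in>{1..n}. \<forall>u\<in>set_pmf (coin P i). \<forall>x\<in>{1..k}. chan P i u x = rappor k \<rho> x)"

definition outcome :: "nat \<Rightarrow> ('u, 'y) protocol \<Rightarrow> nat pmf \<Rightarrow> bool pmf" where
  "outcome n P p =
     bind_pmf (Pi_pmf {1..n} undefined (coin P)) (\<lambda>u.
     bind_pmf (Pi_pmf {1..n} undefined (\<lambda>_. p)) (\<lambda>x.
     bind_pmf (Pi_pmf {1..n} undefined (\<lambda>i. chan P i (u i) (x i))) (\<lambda>y.
     referee P y)))"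

definition solves_identity_testing ::
    "nat \<Rightarrow> nat \<Rightarrow> real \<Rightarrow> real \<Rightarrow> nat pmf \<Rightarrow> ('u, 'y) protocol \<Rightarrow> bool" where
  "solves_identity_testing n k \<epsilon> \<delta> q P \<longleftrightarrow>
     pmf (outcome n P q) True > 1 - \<delta> \<and>
     (\<forall>p\<in>distributions_on k. tv_dist k p q > \<epsilon> \<longrightarrow> pmf (outcome n P p) False > 1 - \<delta>)"

end

theory Submission
  imports Defs
begin

text \<open>
  Every bit \<open>j\<close> of a RAPPOR message is Bernoulli with mean \<open>\<alpha> + \<beta> p\<^sub>j\<close>, where \<open>\<alpha>\<close> is the flip
  probability and \<open>\<beta> = 1 - 2\<alpha> \<ge> \<rho> / 6\<close>. Take two disjoint blocks of \<open>m\<close> players, let \<open>S\<close> and \<open>S'\<close> be the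
  sums over the two blocks of the messages recentred at the means under \<open>q\<close>, and use the statistic
  \<open>\<langle>S, S'\<rangle>\<close>. By independence of the blocks, its mean is \<open>m\<^sup>2 D\<close> with \<open>D = \<beta>\<^sup>2 |p - q|\<^sup>2\<close> (Euclidean norm),
  and its variance is \<open>m\<^sup>2 tr(\<Sigma>\<^sup>2) + 2 m\<^sup>3 d\<^sup>T \<Sigma> d \<le> 4 k m\<^sup>2 + 2 m\<^sup>3 D\<close>, where \<open>d = \<beta> (p - q)\<close> and \<open>\<Sigma>\<close> is the
  covariance matrix of a message, a diagonal matrix with entries in \<open>[0, 1]\<close> minus \<open>\<beta>\<^sup>2 p p\<^sup>T\<close>.
  Cauchy-Schwarz gives \<open>D \<ge> 4 \<beta>\<^sup>2 \<epsilon>\<^sup>2 / k\<close> when \<open>p\<close> is \<open>\<epsilon>\<close>-far from \<open>q\<close>, so by Chebyshev a block size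
  \<open>m\<close> of order \<open>k\<^bsup>3/2\<^esup> / (\<epsilon>\<^sup>2 \<rho>\<^sup>2)\<close> makes the test err with probability at most \<open>1/16\<close>. A majority vote of
  \<open>r \<ge> log\<^sub>2 (1/\<delta>)\<close> such tests errs with probability below \<open>2\<^bsup>-r\<^esup> \<le> \<delta>\<close>. For \<open>\<delta> > 1/2\<close>, where the number of
  players may be too small to form blocks, the referee tosses a fair coin.
\<close>

section \<open>Independence of disjoint coordinate sets under finite product distributions\<close>

text \<open>Stands in for measurability with respect to the coordinates in \<open>A\<close>:
  functions determined by disjoint sets are independent under a product distribution.\<close>

definition determined_by :: "'i set \<Rightarrow> (('i \<Rightarrow> 'a) \<Rightarrow> 'b) \<Rightarrow> bool" where
  "determined_by A f \<longleftrightarrow> (\<forall>x y. (\<forall>i\<in>A. x i = y i) \<longrightarrow> f x = f y)"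

lemma determined_byI:
  "(\<And>x y. (\<And>i. i \<in> A \<Longrightarrow> x i = y i) \<Longrightarrow> f x = f y) \<Longrightarrow> determined_by A f"
  unfolding determined_by_def by blast

lemma determined_byD:
  "determined_by A f \<Longrightarrow> (\<And>i. i \<in> A \<Longrightarrow> x i = y i) \<Longrightarrow> f x = f y"
  unfolding determined_by_def by blast

lemma finite_set_Pi_pmf:
  assumes "finite I" "\<And>i. i \<in> I \<Longrightarrow> finite (set_pmf (M i))"
  shows "finite (set_pmf (Pi_pmf I d M))"
  using assms by (simp add: set_Pi_pmf finite_PiE_dflt)

text \<open>Finite supports turn all three expectations into finite sums, so that factoring a double
  sum is enough and integrability does not arise.\<close>

lemma expectation_pair_pmf_mult:
  fixes f :: "'a \<Rightarrow> real" and g :: "'b \<Rightarrow> real"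
  assumes "finite (set_pmf M)" "finite (set_pmf N)"
  shows "measure_pmf.expectation (pair_pmf M N) (\<lambda>x. f (fst x) * g (snd x)) =
           measure_pmf.expectation M f * measure_pmf.expectation N g"
proof -
  have "measure_pmf.expectation (pair_pmf M N) (\<lambda>x. f (fst x) * g (snd x)) =
          (\<Sum>x\<in>set_pmf M \<times> set_pmf N. f (fst x) * g (snd x) * pmf (pair_pmf M N) x)"
    by (rule integral_measure_pmf_real) (use assms in \<open>auto simp: set_pmf_iff\<close>)
  also have "\<dots> = (\<Sum>x\<in>set_pmf M \<times> set_pmf N. (f (fst x) * pmf M (fst x)) * (g (snd x) * pmf N (snd x)))"
    by (rule sum.cong) (auto simp: pmf_pair)
  also have "\<dots> = (\<Sum>x\<in>set_pmf M. f x * pmf M x) * (\<Sum>y\<in>set_pmf N. g y * pmf N y)"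
    by (simp add: sum_product sum.cartesian_product case_prod_unfold)
  also have "(\<Sum>x\<in>set_pmf M. f x * pmf M x) = measure_pmf.expectation M f"
    by (rule integral_measure_pmf_real[symmetric]) (use assms in \<open>auto simp: set_pmf_iff\<close>)
  also have "(\<Sum>y\<in>set_pmf N. g y * pmf N y) = measure_pmf.expectation N g"
    by (rule integral_measure_pmf_real[symmetric]) (use assms in \<open>auto simp: set_pmf_iff\<close>)
  finally show ?thesis .
qed

text \<open>The product over \<open>I\<close> is an independent pair of products over
  \<open>A\<close> and \<open>I - A\<close>. The first component alone decides \<open>f\<close>, and
  since \<open>B\<close> avoids \<open>A\<close>, the second alone decides \<open>g\<close>.\<close>

lemma expectation_Pi_pmf_mult:
  fixes f g :: "('i \<Rightarrow> 'a) \<Rightarrow> real"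
  assumes I: "finite I" "A \<subseteq> I" "B \<subseteq> I" "A \<inter> B = {}"
    and fin: "\<And>i. i \<in> I \<Longrightarrow> finite (set_pmf (M i))"
    and f: "determined_by A f" and g: "determined_by B g"
  shows "measure_pmf.expectation (Pi_pmf I d M) (\<lambda>x. f x * g x) =
           measure_pmf.expectation (Pi_pmf I d M) f * measure_pmf.expectation (Pi_pmf I d M) g"
proof -
  let ?P = "Pi_pmf A d M" and ?Q = "Pi_pmf (I - A) d M"
  let ?h = "\<lambda>(u, v) x. if x \<in> A then u x else v x"
  have split: "Pi_pmf I d M = map_pmf ?h (pair_pmf ?P ?Q)"
    using Pi_pmf_union[of A "I - A" d M] I by (simp add: finite_subset Un_absorb1)
  have f': "f (?h w) = f (fst w)" for w
    by (rule determined_byD[OF f]) (auto simp: case_prod_unfold)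
  have g': "g (?h w) = g (snd w)" for w
    by (rule determined_byD[OF g]) (use I in \<open>auto simp: case_prod_unfold\<close>)
  have finP: "finite (set_pmf ?P)" "finite (set_pmf ?Q)"
    using I(1,2) fin by (auto intro!: finite_set_Pi_pmf simp: finite_subset)
  show ?thesis
    unfolding split integral_map_pmf f' g' expectation_pair_pmf_mult[OF finP]
      expectation_pair_pmf_fst expectation_pair_pmf_snd ..
qed

lemma expectation_Pi_pmf_coordinate:
  fixes f :: "'a \<Rightarrow> real"
  assumes "finite I" "i \<in> I"
  shows "measure_pmf.expectation (Pi_pmf I d M) (\<lambda>x. f (x i)) = measure_pmf.expectation (M i) f"
proof -
  have "measure_pmf.expectation (Pi_pmf I d M) (\<lambda>x. f (x i)) =
        measure_pmf.expectation (map_pmf (\<lambda>x. x i) (Pi_pmf I d M)) f" by simp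
  then show ?thesis using assms by (simp add: Pi_pmf_component)
qed

section \<open>Amplification by majority vote\<close>

text \<open>Induction on \<open>r\<close>: the last factor depends on coordinates disjoint from all
  earlier ones and splits off. This bounds the exponential moment of the number of failing
  blocks.\<close>

lemma expectation_Pi_pmf_prod_le:
  fixes f :: "nat \<Rightarrow> ('i \<Rightarrow> 'a) \<Rightarrow> real"
  assumes I: "finite I" "\<And>s. s < r \<Longrightarrow> A s \<subseteq> I" "disjoint_family_on A {..<r}"
    and fin: "\<And>i. i \<in> I \<Longrightarrow> finite (set_pmf (M i))"
    and f: "\<And>s. s < r \<Longrightarrow> determined_by (A s) (f s)"
    and nn: "\<And>s x. s < r \<Longrightarrow> 0 \<le> f s x"
    and le: "\<And>s. s < r \<Longrightarrow> measure_pmf.expectation (Pi_pmf I d M) (f s) \<le> c"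
  shows "measure_pmf.expectation (Pi_pmf I d M) (\<lambda>x. \<Prod>s<r. f s x) \<le> c ^ r"
  using assms
proof (induction r)
  case (Suc r)
  let ?E = "measure_pmf.expectation (Pi_pmf I d M)"
  have "?E (\<lambda>x. \<Prod>s<Suc r. f s x) = ?E (\<lambda>x. (\<Prod>s<r. f s x) * f r x)"
    by simp
  also have "\<dots> = ?E (\<lambda>x. \<Prod>s<r. f s x) * ?E (f r)"
  proof (rule expectation_Pi_pmf_mult)
    show "(\<Union>s<r. A s) \<inter> A r = {}"
    proof -
      have "A s \<inter> A r = {}" if "s < r" for s
        using Suc.prems(3) that by (intro disjoint_family_onD[of A "{..<Suc r}"]) auto
      then show ?thesis by blast
    qed
    show "(\<Union>s<r. A s) \<subseteq> I" "A r \<subseteq> I"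
      using Suc.prems(2) less_SucI by blast+
    show "determined_by (A r) (f r)" by (rule Suc.prems(5)) simp
    show "determined_by (\<Union>s<r. A s) (\<lambda>x. \<Prod>s<r. f s x)"
      by (intro determined_byI prod.cong refl determined_byD[OF Suc.prems(5)]) auto
    show "finite I" by fact
    show "finite (set_pmf (M i))" if "i \<in> I" for i using that by (rule Suc.prems(4))
  qed
  also have "\<dots> \<le> c ^ r * c"
  proof (rule mult_mono)
    show "?E (\<lambda>x. \<Prod>s<r. f s x) \<le> c ^ r"
      by (rule Suc.IH) (use Suc.prems in \<open>auto simp: disjoint_family_on_def\<close>)
    show "?E (f r) \<le> c" using Suc.prems by simp
    \<comment> \<open>The sign of \<open>c\<close> comes from the nonnegative expectation that it
      bounds; it is needed for monotonicity of the product.\<close>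
    have "0 \<le> ?E (f r)" using Suc.prems(6) by simp
    also have "\<dots> \<le> c" by fact
    finally show "0 \<le> c ^ r" by simp
    show "0 \<le> ?E (f r)" by fact
  qed
  finally show ?case by (simp add: mult.commute)
qed simp

text \<open>Chernoff bound: \<open>16 ^ (number of failures)\<close> has expectation below \<open>2 ^ r\<close>, and a failed
  majority makes it at least \<open>4 ^ r\<close>.\<close>

lemma majority_failure_prob:
  fixes M :: "'i \<Rightarrow> 'a pmf"
  assumes I: "finite I" "\<And>s. s < r \<Longrightarrow> A s \<subseteq> I" "disjoint_family_on A {..<r}"
    and fin: "\<And>i. i \<in> I \<Longrightarrow> finite (set_pmf (M i))"
    and F: "\<And>s. s < r \<Longrightarrow> determined_by (A s) (F s)"
    and le: "\<And>s. s < r \<Longrightarrow> measure_pmf.prob (Pi_pmf I d M) {x. F s x} \<le> 1 / 16"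
    and r: "0 < r"
  shows "measure_pmf.prob (Pi_pmf I d M) {x. r \<le> 2 * card {s. s < r \<and> F s x}} < (1 / 2) ^ r"
proof -
  let ?P = "Pi_pmf I d M"
  let ?E = "measure_pmf.expectation ?P"
  \<comment> \<open>This is 16 to the power of the indicator, written in affine form so that its
    expectation is at most 1 + 15/16 = 31/16.\<close>
  define f where "f s x = (1::real) + 15 * indicator {x. F s x} x" for s and x :: "'i \<Rightarrow> 'a"
  have int: "integrable (measure_pmf ?P) h" for h :: "_ \<Rightarrow> real"
    by (rule integrable_measure_pmf_finite, rule finite_set_Pi_pmf) (use I fin in auto)
  have Ef: "?E (f s) \<le> 31 / 16" if "s < r" for s
  proof -
    have "?E (f s) = 1 + 15 * measure_pmf.prob ?P {x. F s x}"
      unfolding f_def by (subst Bochner_Integration.integral_add[OF int int]) simp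
    then show ?thesis using le[OF that] by simp
  qed
  have "?E (\<lambda>x. \<Prod>s<r. f s x) \<le> (31 / 16) ^ r"
  proof (intro expectation_Pi_pmf_prod_le[where A = A] I fin Ef)
    show "determined_by (A s) (f s)" if "s < r" for s
      using F[OF that] by (auto simp: f_def determined_by_def indicator_def)
  qed (auto simp: f_def)
  \<comment> \<open>The slack between 31/16 and 2, together with \<open>0 < r\<close>, makes the
    final bound strict, as the strict success probability requires.\<close>
  also have "\<dots> < 2 ^ r" using r by (intro power_strict_mono) auto
  finally have lt: "?E (\<lambda>x. \<Prod>s<r. f s x) < 2 ^ r" .
  have prodf: "(\<Prod>s<r. f s x) = 16 ^ card {s. s < r \<and> F s x}" for x
  proof -
    have "(\<Prod>s<r. f s x) = (\<Prod>s<r. if F s x then 16 else 1)"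
      by (rule prod.cong) (auto simp: f_def)
    also have "\<dots> = (\<Prod>s\<in>{s\<in>{..<r}. F s x}. 16)"
      by (rule prod.inter_filter[symmetric]) simp
    finally show ?thesis by simp
  qed
  have "4 ^ r * measure_pmf.prob ?P {x. r \<le> 2 * card {s. s < r \<and> F s x}} =
        ?E (\<lambda>x. 4 ^ r * indicator {x. r \<le> 2 * card {s. s < r \<and> F s x}} x)"
    by simp
  also have "\<dots> \<le> ?E (\<lambda>x. \<Prod>s<r. f s x)"
  proof (rule integral_mono[OF int int])
    fix x
    show "4 ^ r * indicator {x. r \<le> 2 * card {s. s < r \<and> F s x}} x \<le> (\<Prod>s<r. f s x)"
    proof (cases "r \<le> 2 * card {s. s < r \<and> F s x}")
      case True
      then have "(4::real) ^ r \<le> 4 ^ (2 * card {s. s < r \<and> F s x})"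
        by (intro power_increasing) auto
      then show ?thesis using True by (simp add: prodf power_mult)
    qed (simp add: prodf)
  qed
  also note lt
  also have "(2::real) ^ r = 4 ^ r * (1 / 2) ^ r"
    by (simp flip: power_mult_distrib)
  finally show ?thesis by simp
qed

section \<open>Mean and variance of the two-block statistic\<close>

definition feature_sum :: "('j \<Rightarrow> 'y \<Rightarrow> real) \<Rightarrow> 'i set \<Rightarrow> 'j \<Rightarrow> ('i \<Rightarrow> 'y) \<Rightarrow> real" where
  "feature_sum v K j x = (\<Sum>i\<in>K. v j (x i))"

text \<open>An inner product across two disjoint blocks, unlike the squared norm of a single sum,
  has no terms pairing a player with itself, so no covariance enters its mean.\<close>

definition split_stat ::
    "('j \<Rightarrow> 'y \<Rightarrow> real) \<Rightarrow> 'j set \<Rightarrow> 'i set \<Rightarrow> 'i set \<Rightarrow> ('i \<Rightarrow> 'y) \<Rightarrow> real" where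
  "split_stat v J A B x = (\<Sum>j\<in>J. feature_sum v A j x * feature_sum v B j x)"

lemma determined_by_feature_sum: "determined_by K (feature_sum v K j)"
  unfolding determined_by_def feature_sum_def by (auto intro!: sum.cong)

lemma determined_by_split_stat: "determined_by (A \<union> B) (split_stat v J A B)"
  unfolding determined_by_def split_stat_def feature_sum_def
  by (auto intro!: sum.cong arg_cong2[where f = "(*)"])

text \<open>The analysis uses only first and second moments of the features, so the message law and
  the features stay abstract. By \<open>cov\<close>, \<open>c\<close> is the covariance matrix of
  the features and \<open>d\<close> their mean vector.\<close>

locale split_sample =
  fixes I A B :: "'i set" and m :: nat and dflt :: 'y and M :: "'y pmf"
    and J :: "'j set" and v :: "'j \<Rightarrow> 'y \<Rightarrow> real" and d :: "'j \<Rightarrow> real" and c :: "'j \<Rightarrow> 'j \<Rightarrow> real"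
  assumes finite_I: "finite I" and finite_M: "finite (set_pmf M)"
    and subset_I: "A \<subseteq> I" "B \<subseteq> I" and disjoint: "A \<inter> B = {}"
    and card_blocks: "card A = m" "card B = m"
    and mean: "\<And>j. j \<in> J \<Longrightarrow> measure_pmf.expectation M (v j) = d j"
    and cov: "\<And>j l. j \<in> J \<Longrightarrow> l \<in> J \<Longrightarrow>
      measure_pmf.expectation M (\<lambda>y. v j y * v l y) = c j l + d j * d l"
begin

abbreviation "P \<equiv> Pi_pmf I dflt (\<lambda>_. M)"
abbreviation E :: "(('i \<Rightarrow> 'y) \<Rightarrow> real) \<Rightarrow> real" where "E \<equiv> measure_pmf.expectation P"

abbreviation "stat \<equiv> split_stat v J A B"

lemma integrable_P [simp]: "integrable (measure_pmf P) (f :: _ \<Rightarrow> real)"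
  by (rule integrable_measure_pmf_finite, rule finite_set_Pi_pmf) (simp_all add: finite_I finite_M)

lemma expectation_split:
  fixes f g :: "('i \<Rightarrow> 'y) \<Rightarrow> real"
  assumes "determined_by A f" "determined_by B g"
  shows "E (\<lambda>x. f x * g x) = E f * E g"
  using assms finite_I finite_M subset_I disjoint by (intro expectation_Pi_pmf_mult) auto

lemma expectation_coordinate:
  assumes "i \<in> I" "j \<in> J"
  shows "E (\<lambda>x. v j (x i)) = d j"
  using expectation_Pi_pmf_coordinate[OF finite_I assms(1), of dflt "\<lambda>_. M" "v j"] mean[OF assms(2)]
  by simp

lemma expectation_feature_sum:
  assumes "K \<subseteq> I" "j \<in> J"
  shows "E (feature_sum v K j) = real (card K) * d j"
proof -
  have "E (feature_sum v K j) = (\<Sum>i\<in>K. E (\<lambda>x. v j (x i)))"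
    unfolding feature_sum_def by (rule Bochner_Integration.integral_sum) simp
  also have "\<dots> = (\<Sum>i\<in>K. d j)"
    using assms by (intro sum.cong) (auto simp: expectation_coordinate)
  finally show ?thesis by simp
qed

text \<open>Distinct players are independent and contribute only the product of means; the
  \<open>card K\<close> diagonal pairs each add one covariance.\<close>

lemma expectation_feature_sum_mult:
  assumes K: "K \<subseteq> I" and "j \<in> J" "l \<in> J"
  shows "E (\<lambda>x. feature_sum v K j x * feature_sum v K l x) = real (card K) * c j l + (real (card K))\<^sup>2 * (d j * d l)"
proof -
  have fin: "finite K" using K finite_I finite_subset by blast
  have pair: "E (\<lambda>x. v j (x i) * v l (x i')) = (if i = i' then c j l else 0) + d j * d l"
    if "i \<in> K" "i' \<in> K" for i i'
  proof (cases "i = i'")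
    case True
    then show ?thesis
      using that assms finite_I
      by (auto simp: expectation_Pi_pmf_coordinate[where f = "\<lambda>y. v j y * v l y"] cov)
  next
    case False
    have "E (\<lambda>x. v j (x i) * v l (x i')) = E (\<lambda>x. v j (x i)) * E (\<lambda>x. v l (x i'))"
      by (rule expectation_Pi_pmf_mult[of _ "{i}" "{i'}"])
         (use that assms finite_I finite_M False in \<open>auto simp: determined_by_def\<close>)
    also have "\<dots> = d j * d l"
      using that assms by (simp add: expectation_coordinate subset_iff)
    finally show ?thesis using False by simp
  qed
  have "E (\<lambda>x. feature_sum v K j x * feature_sum v K l x) =
        E (\<lambda>x. \<Sum>i\<in>K. \<Sum>i'\<in>K. v j (x i) * v l (x i'))"
    by (simp add: feature_sum_def sum_product)
  also have "\<dots> = (\<Sum>i\<in>K. \<Sum>i'\<in>K. E (\<lambda>x. v j (x i) * v l (x i')))"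
    by (simp add: Bochner_Integration.integral_sum)
  also have "\<dots> = (\<Sum>i\<in>K. \<Sum>i'\<in>K. (if i = i' then c j l else 0) + d j * d l)"
    by (intro sum.cong refl pair)
  also have "\<dots> = real (card K) * c j l + (real (card K))\<^sup>2 * (d j * d l)"
    by (simp add: sum.distrib fin power2_eq_square algebra_simps)
  finally show ?thesis .
qed

lemma expectation_stat: "E stat = (real m)\<^sup>2 * (\<Sum>j\<in>J. (d j)\<^sup>2)"
proof -
  have "E stat = (\<Sum>j\<in>J. E (\<lambda>x. feature_sum v A j x * feature_sum v B j x))"
    unfolding split_stat_def by (rule Bochner_Integration.integral_sum) simp
  also have "\<dots> = (\<Sum>j\<in>J. (real m)\<^sup>2 * (d j)\<^sup>2)"
    using subset_I card_blocks
    by (intro sum.cong) (auto simp: expectation_split determined_by_feature_sum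
        expectation_feature_sum power2_eq_square)
  finally show ?thesis by (simp add: sum_distrib_left)
qed

text \<open>After squaring, each summand regroups into a factor from block \<open>A\<close> and one
  from block \<open>B\<close>. They are independent and, the blocks having equal size, have the same
  expectation, hence the square.\<close>

lemma expectation_stat_sq:
  "E (\<lambda>x. (stat x)\<^sup>2) = (\<Sum>j\<in>J. \<Sum>l\<in>J. (real m * c j l + (real m)\<^sup>2 * (d j * d l))\<^sup>2)"
proof -
  have "E (\<lambda>x. (stat x)\<^sup>2) = E (\<lambda>x. \<Sum>j\<in>J. \<Sum>l\<in>J.
          (feature_sum v A j x * feature_sum v A l x) * (feature_sum v B j x * feature_sum v B l x))"
    by (simp add: split_stat_def power2_eq_square sum_product mult_ac)
  also have "\<dots> = (\<Sum>j\<in>J. \<Sum>l\<in>J. E (\<lambda>x.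
          (feature_sum v A j x * feature_sum v A l x) * (feature_sum v B j x * feature_sum v B l x)))"
    by (simp add: Bochner_Integration.integral_sum)
  also have "\<dots> = (\<Sum>j\<in>J. \<Sum>l\<in>J. (real m * c j l + (real m)\<^sup>2 * (d j * d l))\<^sup>2)"
  proof (intro sum.cong refl)
    fix j l assume jl: "j \<in> J" "l \<in> J"
    have dt: "determined_by K (\<lambda>x. feature_sum v K j x * feature_sum v K l x)" for K
      using determined_by_feature_sum[of K v j] determined_by_feature_sum[of K v l]
      unfolding determined_by_def by metis
    show "E (\<lambda>x. (feature_sum v A j x * feature_sum v A l x) * (feature_sum v B j x * feature_sum v B l x)) =
          (real m * c j l + (real m)\<^sup>2 * (d j * d l))\<^sup>2"
      by (subst expectation_split[OF dt dt])
         (use jl subset_I card_blocks in \<open>simp add: expectation_feature_sum_mult power2_eq_square\<close>)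
  qed
  finally show ?thesis .
qed

text \<open>The fourth-order terms in \<open>m\<close> cancel against the squared mean. What remains
  is the squared Frobenius norm of \<open>c\<close> and its quadratic form at
  \<open>d\<close>.\<close>

lemma variance_stat:
  "measure_pmf.variance P stat =
     (real m)\<^sup>2 * (\<Sum>j\<in>J. \<Sum>l\<in>J. (c j l)\<^sup>2) + 2 * real m ^ 3 * (\<Sum>j\<in>J. \<Sum>l\<in>J. c j l * d j * d l)"
proof -
  have "measure_pmf.variance P stat = E (\<lambda>x. (stat x)\<^sup>2) - (E stat)\<^sup>2"
    by (rule measure_pmf.variance_eq) simp_all
  also have "(E stat)\<^sup>2 = (\<Sum>j\<in>J. \<Sum>l\<in>J. ((real m)\<^sup>2 * (d j * d l))\<^sup>2)"
    by (simp add: expectation_stat power_mult_distrib sum_distrib_left sum_product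
        power2_eq_square[of "sum _ _"] mult_ac)
  also have "E (\<lambda>x. (stat x)\<^sup>2) - \<dots> =
      (\<Sum>j\<in>J. \<Sum>l\<in>J. (real m)\<^sup>2 * (c j l)\<^sup>2 + 2 * real m ^ 3 * (c j l * d j * d l))"
    unfolding expectation_stat_sq sum_subtractf[symmetric]
    by (intro sum.cong refl) (simp add: power2_eq_square power3_eq_cube algebra_simps)
  also have "\<dots> = (real m)\<^sup>2 * (\<Sum>j\<in>J. \<Sum>l\<in>J. (c j l)\<^sup>2) + 2 * real m ^ 3 * (\<Sum>j\<in>J. \<Sum>l\<in>J. c j l * d j * d l)"
    by (simp add: sum.distrib sum_distrib_left)
  finally show ?thesis .
qed

lemma stat_deviation_prob:
  fixes a U V :: real
  assumes "0 < a"
    and "(\<Sum>j\<in>J. \<Sum>l\<in>J. (c j l)\<^sup>2) \<le> U" "(\<Sum>j\<in>J. \<Sum>l\<in>J. c j l * d j * d l) \<le> V"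
  shows "measure_pmf.prob P {x. a \<le> \<bar>stat x - (real m)\<^sup>2 * (\<Sum>j\<in>J. (d j)\<^sup>2)\<bar>} \<le> ((real m)\<^sup>2 * U + 2 * real m ^ 3 * V) / a\<^sup>2"
proof -
  have "measure_pmf.prob P {x\<in>space P. a \<le> \<bar>stat x - E stat\<bar>} \<le> measure_pmf.variance P stat / a\<^sup>2"
    by (rule measure_pmf.Chebyshev_inequality) (use assms in simp_all)
  also have "\<dots> \<le> ((real m)\<^sup>2 * U + 2 * real m ^ 3 * V) / a\<^sup>2"
    unfolding variance_stat
    by (intro divide_right_mono add_mono mult_left_mono assms) auto
  finally show ?thesis by (simp add: expectation_stat)
qed

end

section \<open>RAPPOR: privacy and moments of its bits\<close>

definition flip_prob :: "real \<Rightarrow> real" where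
  "flip_prob \<rho> = 1 / (exp (\<rho> / 2) + 1)"

definition gap :: "real \<Rightarrow> real" where
  "gap \<rho> = 1 - 2 * flip_prob \<rho>"

lemma flip_prob_bounds: "0 < flip_prob \<rho>" "flip_prob \<rho> < 1"
proof -
  have "0 < exp (\<rho> / 2)" by simp
  then show "0 < flip_prob \<rho>" "flip_prob \<rho> < 1"
    unfolding flip_prob_def by (auto simp: field_simps add_pos_pos simp del: exp_gt_zero)
qed

lemma flip_ratio: "1 - flip_prob \<rho> = exp (\<rho> / 2) * flip_prob \<rho>"
proof -
  have "exp (\<rho> / 2) + 1 \<noteq> 0" using exp_gt_zero[of "\<rho> / 2"] by linarith
  then show ?thesis unfolding flip_prob_def by (simp add: field_simps)
qed

text \<open>The gap is (e^(\<rho>/2) - 1) / (e^(\<rho>/2) + 1). Its numerator is at least \<rho>/2,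
  and its denominator is at most 3 because e^(\<rho>/2) \<le> 2 for \<rho> \<le> 1.\<close>

lemma gap_ge:
  assumes "0 < \<rho>" "\<rho> \<le> 1"
  shows "\<rho> / 6 \<le> gap \<rho>"
proof -
  have "(exp (\<rho> / 2))\<^sup>2 = exp \<rho>" by (simp flip: exp_double)
  also have "\<dots> \<le> exp 1" using assms by simp
  also have "\<dots> \<le> 2\<^sup>2" using exp_le by simp
  finally have up: "exp (\<rho> / 2) \<le> 2" by (rule power2_le_imp_le) simp
  have lo: "\<rho> / 2 \<le> exp (\<rho> / 2) - 1" using exp_ge_add_one_self[of "\<rho> / 2"]
    by (simp only: le_diff_eq add.commute)
  have pos: "0 < exp (\<rho> / 2) + 1" by (simp add: add_pos_pos)
  have "\<rho> / 6 * (exp (\<rho> / 2) + 1) \<le> \<rho> / 6 * (2 + 1)"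
    using assms up by (intro mult_left_mono) auto
  also have "\<dots> = \<rho> / 2" by simp
  also note lo
  finally have "\<rho> / 6 \<le> (exp (\<rho> / 2) - 1) / (exp (\<rho> / 2) + 1)"
    using pos by (simp add: pos_le_divide_eq)
  also have "\<dots> = gap \<rho>"
    using pos by (simp add: gap_def flip_prob_def field_simps)
  finally show ?thesis .
qed

definition bit_channel :: "real \<Rightarrow> nat \<Rightarrow> nat \<Rightarrow> bool pmf" where
  "bit_channel \<rho> x j =
     map_pmf (\<lambda>flip. if flip then \<not> (x = j) else x = j) (bernoulli_pmf (flip_prob \<rho>))"

lemma rappor_eq: "rappor k \<rho> x = Pi_pmf {1..k} False (bit_channel \<rho> x)"
  by (simp add: rappor_def bit_channel_def flip_prob_def cong: Pi_pmf_cong)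

lemma pmf_bit_channel:
  "pmf (bit_channel \<rho> x j) b = (if b = (x = j) then 1 - flip_prob \<rho> else flip_prob \<rho>)"
proof -
  let ?f = "\<lambda>flip. if flip then \<not> (x = j) else x = j"
  have "inj ?f" by (auto simp: inj_def)
  from pmf_map_inj'[OF this, of "bernoulli_pmf (flip_prob \<rho>)" "b \<noteq> (x = j)"]
  show ?thesis
    using flip_prob_bounds[of \<rho>] by (cases b; cases "x = j") (simp_all add: bit_channel_def cong: if_cong)
qed

lemma expectation_bit_channel:
  "measure_pmf.expectation (bit_channel \<rho> x j) of_bool = flip_prob \<rho> + gap \<rho> * of_bool (x = j)"
proof -
  have "measure_pmf.expectation (bit_channel \<rho> x j) of_bool =
        (\<Sum>b\<in>UNIV. of_bool b * pmf (bit_channel \<rho> x j) b)"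
    by (rule integral_measure_pmf_real) auto
  then show ?thesis by (simp add: UNIV_bool pmf_bit_channel gap_def)
qed

text \<open>The one-hot vectors of \<open>x\<close> and \<open>x'\<close> can differ only at the
  positions \<open>x\<close> and \<open>x'\<close>. Each costs a factor of at most e^(\<rho>/2), and
  two of them make e^\<rho>.\<close>

lemma locally_private_rappor:
  assumes "0 < \<rho>"
  shows "locally_private \<rho> {1..k} (rappor k \<rho>)"
  unfolding locally_private_def
proof (intro allI ballI)
  fix y x x' assume "x \<in> {1..k}" "x' \<in> {1..k}"
  let ?w = "\<lambda>j. if j \<in> {x, x'} then exp (\<rho> / 2) else 1"
  have bit: "pmf (bit_channel \<rho> x' j) b \<le> ?w j * pmf (bit_channel \<rho> x j) b" for j b
  proof -
    let ?f = "flip_prob \<rho>" and ?e = "exp (\<rho> / 2)"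
    have 1: "a \<le> ?e * a" if "0 \<le> a" for a :: real
      using mult_right_mono[of 1 ?e a] assms that by simp
    have 2: "?f \<le> ?e * ?f" "1 - ?f \<le> ?e * (1 - ?f)"
      using flip_prob_bounds[of \<rho>] by (intro 1; simp)+
    \<comment> \<open>These are the cases in which the unflipped bits differ; the first is an
      equality by \<open>flip_ratio\<close>.\<close>
    have 3: "1 - ?f \<le> ?e * ?f" "?f \<le> ?e * (1 - ?f)"
      using 2 unfolding flip_ratio by (blast intro: order.trans)+
    show ?thesis using 2 3 by (auto simp: pmf_bit_channel simp del: mult_le_cancel_right2)
  qed
  have w: "(\<Prod>j\<in>{1..k}. ?w j) \<le> exp \<rho>"
  proof -
    have "(\<Prod>j\<in>{1..k}. ?w j) = (\<Prod>j\<in>{j\<in>{1..k}. j \<in> {x, x'}}. exp (\<rho> / 2))"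
      by (rule prod.inter_filter[symmetric]) simp
    also have "\<dots> = exp (\<rho> / 2) ^ card {j\<in>{1..k}. j \<in> {x, x'}}" by simp
    also have "\<dots> \<le> exp (\<rho> / 2) ^ 2"
    proof (rule power_increasing)
      have "card {j\<in>{1..k}. j \<in> {x, x'}} \<le> card {x, x'}" by (rule card_mono) auto
      also have "\<dots> \<le> 2" by (simp add: card_insert_if)
      finally show "card {j\<in>{1..k}. j \<in> {x, x'}} \<le> 2" .
    qed (use assms in simp)
    also have "\<dots> = exp \<rho>" by (simp flip: exp_double)
    finally show ?thesis .
  qed
  have "(\<Prod>j\<in>{1..k}. pmf (bit_channel \<rho> x' j) (y j)) \<le>
        (\<Prod>j\<in>{1..k}. ?w j * pmf (bit_channel \<rho> x j) (y j))"
    by (intro prod_mono conjI bit) simp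
  also have "\<dots> = (\<Prod>j\<in>{1..k}. ?w j) * (\<Prod>j\<in>{1..k}. pmf (bit_channel \<rho> x j) (y j))"
    by (rule prod.distrib)
  also have "\<dots> \<le> exp \<rho> * (\<Prod>j\<in>{1..k}. pmf (bit_channel \<rho> x j) (y j))"
    by (intro mult_right_mono w prod_nonneg) simp
  \<comment> \<open>A vector \<open>y\<close> that is true somewhere outside \<open>{1..k}\<close>
    has probability 0 under both inputs.\<close>
  finally show "pmf (rappor k \<rho> x') y \<le> exp \<rho> * pmf (rappor k \<rho> x) y"
    by (auto simp: rappor_eq pmf_Pi)
qed

lemma finite_set_rappor: "finite (set_pmf (rappor k \<rho> x))"
  unfolding rappor_eq by (rule finite_set_Pi_pmf) auto

lemma expectation_rappor_bit:
  assumes "j \<in> {1..k}"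
  shows "measure_pmf.expectation (rappor k \<rho> x) (\<lambda>y. of_bool (y j)) =
           flip_prob \<rho> + gap \<rho> * of_bool (x = j)"
  unfolding rappor_eq
  using assms by (subst expectation_Pi_pmf_coordinate) (auto simp: expectation_bit_channel)

lemma expectation_rappor_bits:
  assumes "j \<in> {1..k}" "l \<in> {1..k}" "j \<noteq> l"
  shows "measure_pmf.expectation (rappor k \<rho> x) (\<lambda>y. of_bool (y j) * of_bool (y l)) =
           (flip_prob \<rho> + gap \<rho> * of_bool (x = j)) * (flip_prob \<rho> + gap \<rho> * of_bool (x = l))"
proof -
  have "measure_pmf.expectation (rappor k \<rho> x) (\<lambda>y. of_bool (y j) * of_bool (y l)) =
        measure_pmf.expectation (rappor k \<rho> x) (\<lambda>y. of_bool (y j)) *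
        (measure_pmf.expectation (rappor k \<rho> x) (\<lambda>y. of_bool (y l)) :: real)"
    unfolding rappor_eq
    by (rule expectation_Pi_pmf_mult[of _ "{j}" "{l}"]) (use assms in \<open>auto simp: determined_by_def\<close>)
  then show ?thesis using assms by (simp add: expectation_rappor_bit)
qed

section \<open>Moments of a message with a random sample\<close>

definition message :: "nat \<Rightarrow> real \<Rightarrow> nat pmf \<Rightarrow> (nat \<Rightarrow> bool) pmf" where
  "message k \<rho> p = bind_pmf p (rappor k \<rho>)"

context
  fixes k :: nat and \<rho> :: real and p :: "nat pmf"
  assumes p: "p \<in> distributions_on k"
begin

lemma finite_set_message: "finite (set_pmf (message k \<rho> p))"
  using p finite_subset[of "set_pmf p" "{1..k}"]
  by (auto simp: message_def distributions_on_def finite_set_rappor)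

lemma sum_pmf_distribution: "(\<Sum>x\<in>{1..k}. pmf p x) = 1"
  using p by (intro sum_pmf_eq_1) (auto simp: distributions_on_def)

lemma expectation_message:
  fixes h :: "(nat \<Rightarrow> bool) \<Rightarrow> real"
  shows "measure_pmf.expectation (message k \<rho> p) h =
           (\<Sum>x\<in>{1..k}. pmf p x * measure_pmf.expectation (rappor k \<rho> x) h)"
  unfolding message_def using p
  by (subst pmf_expectation_bind[where A = "{1..k}"])
     (auto simp: distributions_on_def finite_set_rappor)

lemma sum_pmf_of_bool:
  assumes "j \<in> {1..k}"
  shows "(\<Sum>x\<in>{1..k}. pmf p x * of_bool (x = j)) = pmf p j"
proof -
  have "(\<Sum>x\<in>{1..k}. pmf p x * of_bool (x = j)) = (\<Sum>x\<in>{1..k}. if x = j then pmf p x else 0)"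
    by (intro sum.cong) auto
  then show ?thesis using assms by simp
qed

lemma expectation_message_bit:
  assumes "j \<in> {1..k}"
  shows "measure_pmf.expectation (message k \<rho> p) (\<lambda>y. of_bool (y j)) = flip_prob \<rho> + gap \<rho> * pmf p j"
proof -
  have "measure_pmf.expectation (message k \<rho> p) (\<lambda>y. of_bool (y j)) =
        (\<Sum>x\<in>{1..k}. flip_prob \<rho> * pmf p x + gap \<rho> * (pmf p x * of_bool (x = j)))"
    using assms by (simp add: expectation_message expectation_rappor_bit algebra_simps)
  then show ?thesis
    using sum_pmf_of_bool[OF assms]
    by (simp only: sum.distrib flip: sum_distrib_left) (simp add: sum_pmf_distribution[unfolded One_nat_def])
qed

text \<open>Given the sample, the bits are independent. Averaging over it loses the term quadratic
  in the gap, because \<open>x = j\<close> and \<open>x = l\<close> exclude each other; this is the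
  negative correlation of the bits.\<close>

lemma expectation_message_bits:
  assumes "j \<in> {1..k}" "l \<in> {1..k}" "j \<noteq> l"
  shows "measure_pmf.expectation (message k \<rho> p) (\<lambda>y. of_bool (y j) * of_bool (y l)) =
           (flip_prob \<rho> + gap \<rho> * pmf p j) * (flip_prob \<rho> + gap \<rho> * pmf p l)
             - (gap \<rho>)\<^sup>2 * pmf p j * pmf p l"
proof -
  have "measure_pmf.expectation (message k \<rho> p) (\<lambda>y. of_bool (y j) * of_bool (y l)) =
        (\<Sum>x\<in>{1..k}. (flip_prob \<rho>)\<^sup>2 * pmf p x + flip_prob \<rho> * gap \<rho> * (pmf p x * of_bool (x = j))
           + flip_prob \<rho> * gap \<rho> * (pmf p x * of_bool (x = l)))"
    using assms unfolding expectation_message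
    by (intro sum.cong refl) (auto simp: expectation_rappor_bits algebra_simps power2_eq_square)
  also have "\<dots> = (flip_prob \<rho>)\<^sup>2 + flip_prob \<rho> * gap \<rho> * pmf p j + flip_prob \<rho> * gap \<rho> * pmf p l"
    using sum_pmf_of_bool[OF assms(1)] sum_pmf_of_bool[OF assms(2)]
    by (simp only: sum.distrib flip: sum_distrib_left) (simp add: sum_pmf_distribution[unfolded One_nat_def])
  also have "\<dots> = (flip_prob \<rho> + gap \<rho> * pmf p j) * (flip_prob \<rho> + gap \<rho> * pmf p l)
             - (gap \<rho>)\<^sup>2 * pmf p j * pmf p l"
    by (simp add: algebra_simps power2_eq_square)
  finally show ?thesis .
qed

end

section \<open>Covariance matrix and signal strength\<close>

definition centred_bit :: "real \<Rightarrow> nat pmf \<Rightarrow> nat \<Rightarrow> (nat \<Rightarrow> bool) \<Rightarrow> real" where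
  "centred_bit \<rho> q j y = of_bool (y j) - (flip_prob \<rho> + gap \<rho> * pmf q j)"

definition bit_mean :: "real \<Rightarrow> nat pmf \<Rightarrow> nat pmf \<Rightarrow> nat \<Rightarrow> real" where
  "bit_mean \<rho> q p j = gap \<rho> * (pmf p j - pmf q j)"

text \<open>The diagonal part of the covariance matrix before the rank-one correction. The true
  variance of bit \<open>j\<close> is smaller by
  \<open>(gap \<rho>)\<^sup>2 * (pmf p j)\<^sup>2\<close>, which \<open>bit_cov\<close>
  subtracts.\<close>

definition bit_var :: "real \<Rightarrow> nat pmf \<Rightarrow> nat \<Rightarrow> real" where
  "bit_var \<rho> p j = (1 - (gap \<rho>)\<^sup>2) / 4 + (gap \<rho>)\<^sup>2 * pmf p j"

definition bit_cov :: "real \<Rightarrow> nat pmf \<Rightarrow> nat \<Rightarrow> nat \<Rightarrow> real" where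
  "bit_cov \<rho> p j l =
     of_bool (j = l) * bit_var \<rho> p j - (gap \<rho>)\<^sup>2 * pmf p j * pmf p l"

lemma gap_sq_le_1: "(gap \<rho>)\<^sup>2 \<le> 1"
  using flip_prob_bounds[of \<rho>] by (simp add: gap_def abs_square_le_1 abs_le_iff)

lemma bit_var_bounds: "0 \<le> bit_var \<rho> p j" "bit_var \<rho> p j \<le> 1"
proof -
  have "(gap \<rho>)\<^sup>2 * pmf p j \<le> (gap \<rho>)\<^sup>2 * 1" by (intro mult_left_mono pmf_le_1) auto
  moreover have "0 \<le> (gap \<rho>)\<^sup>2 * pmf p j" by simp
  ultimately show "0 \<le> bit_var \<rho> p j" "bit_var \<rho> p j \<le> 1"
    using gap_sq_le_1[of \<rho>] unfolding bit_var_def by argo+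
qed

lemma expectation_centred_bit:
  assumes "p \<in> distributions_on k" "j \<in> {1..k}"
  shows "measure_pmf.expectation (message k \<rho> p) (centred_bit \<rho> q j) = bit_mean \<rho> q p j"
proof -
  have int: "integrable (measure_pmf (message k \<rho> p)) (h :: _ \<Rightarrow> real)" for h
    using assms(1) by (intro integrable_measure_pmf_finite finite_set_message)
  show ?thesis
    unfolding centred_bit_def
    by (subst Bochner_Integration.integral_diff[OF int int])
       (use assms in \<open>simp add: expectation_message_bit bit_mean_def algebra_simps\<close>)
qed

lemma expectation_centred_bit_mult:
  assumes p: "p \<in> distributions_on k" and jl: "j \<in> {1..k}" "l \<in> {1..k}"
  shows "measure_pmf.expectation (message k \<rho> p) (\<lambda>y. centred_bit \<rho> q j y * centred_bit \<rho> q l y) =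
           bit_cov \<rho> p j l + bit_mean \<rho> q p j * bit_mean \<rho> q p l"
proof -
  let ?E = "measure_pmf.expectation (message k \<rho> p) :: (_ \<Rightarrow> real) \<Rightarrow> real"
  let ?a = "\<lambda>j. flip_prob \<rho> + gap \<rho> * pmf p j" and ?t = "\<lambda>j. flip_prob \<rho> + gap \<rho> * pmf q j"
  have int: "integrable (measure_pmf (message k \<rho> p)) (h :: _ \<Rightarrow> real)" for h
    using p by (intro integrable_measure_pmf_finite finite_set_message)
  have raw: "?E (\<lambda>y. of_bool (y j) * of_bool (y l)) = bit_cov \<rho> p j l + ?a j * ?a l"
  proof (cases "j = l")
    case True
    \<comment> \<open>A 0/1 variable equals its square, so the diagonal second moment is just the
      mean.\<close>
    have "?E (\<lambda>y. of_bool (y j) * of_bool (y l)) = ?E (\<lambda>y. of_bool (y j))"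
      using True by (intro Bochner_Integration.integral_cong) auto
    also have "\<dots> = ?a j" using p jl by (simp add: expectation_message_bit)
    also have "\<dots> = bit_cov \<rho> p j l + ?a j * ?a l"
    proof -
      have f: "flip_prob \<rho> = (1 - gap \<rho>) / 2" by (simp add: gap_def)
      show ?thesis
        using True unfolding bit_cov_def bit_var_def f by (simp add: power2_eq_square field_simps)
    qed
    finally show ?thesis .
  next
    case False
    then show ?thesis using p jl by (simp add: expectation_message_bits bit_cov_def)
  qed
  have "?E (\<lambda>y. centred_bit \<rho> q j y * centred_bit \<rho> q l y) =
        ?E (\<lambda>y. of_bool (y j) * of_bool (y l) - ?t l * of_bool (y j) - ?t j * of_bool (y l) + ?t j * ?t l)"
    by (intro Bochner_Integration.integral_cong) (auto simp: centred_bit_def algebra_simps)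
  also have "\<dots> = ?E (\<lambda>y. of_bool (y j) * of_bool (y l)) - ?t l * ?E (\<lambda>y. of_bool (y j))
                   - ?t j * ?E (\<lambda>y. of_bool (y l)) + ?t j * ?t l"
    by (simp only: Bochner_Integration.integral_add[OF int int]
        Bochner_Integration.integral_diff[OF int int] Bochner_Integration.integral_mult_right_zero) simp
  also have "\<dots> = bit_cov \<rho> p j l + bit_mean \<rho> q p j * bit_mean \<rho> q p l"
    using p jl by (simp only: raw expectation_message_bit) (simp add: bit_mean_def algebra_simps)
  finally show ?thesis .
qed

text \<open>By (x - y)^2 \<le> 2 x^2 + 2 y^2 the diagonal and rank-one parts separate. The first
  contributes at most 2k, the second at most 2 since the probabilities sum to 1, and 2k + 2 \<le>
  4k.\<close>

lemma sum_bit_cov_sq_le: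
  assumes p: "p \<in> distributions_on k" and k: "1 \<le> k"
  shows "(\<Sum>j\<in>{1..k}. \<Sum>l\<in>{1..k}. (bit_cov \<rho> p j l)\<^sup>2) \<le> 4 * k"
proof -
  have "(bit_cov \<rho> p j l)\<^sup>2 \<le> (if j = l then 2 else 0) + 2 * (pmf p j * pmf p l)" for j l
  proof -
    define g where "g = (gap \<rho>)\<^sup>2"
    have g: "0 \<le> g" "g \<le> 1" using gap_sq_le_1 by (auto simp: g_def)
    define x where "x = of_bool (j = l) * bit_var \<rho> p j"
    define y where "y = g * (pmf p j * pmf p l)"
    have "0 \<le> x" "x \<le> of_bool (j = l)" by (auto simp: x_def bit_var_bounds)
    then have x: "x\<^sup>2 \<le> of_bool (j = l)"
      using power_mono[of x "of_bool (j = l)" 2] by (cases "j = l") auto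
    have jl: "pmf p j * pmf p l \<le> 1" by (intro mult_le_one pmf_le_1) auto
    have y1: "0 \<le> y" "y \<le> pmf p j * pmf p l"
      using g by (auto simp: y_def intro!: mult_left_le_one_le)
    then have "y * y \<le> 1 * y" using jl by (intro mult_right_mono) auto
    then have y: "y\<^sup>2 \<le> pmf p j * pmf p l" using y1 by (simp add: power2_eq_square)
    have "(bit_cov \<rho> p j l)\<^sup>2 = (x - y)\<^sup>2" by (simp add: bit_cov_def x_def y_def g_def mult.assoc)
    also have "\<dots> \<le> 2 * x\<^sup>2 + 2 * y\<^sup>2"
      using zero_le_power2[of "x + y"] by (simp add: power2_eq_square algebra_simps)
    also have "\<dots> \<le> 2 * of_bool (j = l) + 2 * (pmf p j * pmf p l)" using x y by linarith
    finally show ?thesis by auto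
  qed
  then have "(\<Sum>j\<in>{1..k}. \<Sum>l\<in>{1..k}. (bit_cov \<rho> p j l)\<^sup>2) \<le>
        (\<Sum>j\<in>{1..k}. \<Sum>l\<in>{1..k}. (if j = l then 2 else 0) + 2 * (pmf p j * pmf p l))"
    by (intro sum_mono)
  also have "\<dots> = 2 * k + 2 * ((\<Sum>j\<in>{1..k}. pmf p j) * (\<Sum>l\<in>{1..k}. pmf p l))"
    by (simp only: sum_product) (simp add: sum.distrib sum_distrib_left)
  also have "\<dots> \<le> 4 * k" using k by (simp add: sum_pmf_distribution[OF p, unfolded One_nat_def])
  finally show ?thesis .
qed

text \<open>The rank-one part contributes minus a square and is dropped; the diagonal entries are at
  most 1.\<close>

lemma sum_bit_cov_quadratic_form_le:
  fixes d :: "nat \<Rightarrow> real"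
  shows "(\<Sum>j\<in>{1..k}. \<Sum>l\<in>{1..k}. bit_cov \<rho> p j l * d j * d l) \<le> (\<Sum>j\<in>{1..k}. (d j)\<^sup>2)"
proof -
  define g where "g = (gap \<rho>)\<^sup>2"
  have g: "0 \<le> g" "g \<le> 1" using gap_sq_le_1 by (auto simp: g_def)
  have "(\<Sum>j\<in>{1..k}. \<Sum>l\<in>{1..k}. bit_cov \<rho> p j l * d j * d l) =
        (\<Sum>j\<in>{1..k}. \<Sum>l\<in>{1..k}. (if j = l then bit_var \<rho> p j * (d j)\<^sup>2 else 0) - g * ((pmf p j * d j) * (pmf p l * d l)))"
    by (intro sum.cong refl) (auto simp: bit_cov_def g_def algebra_simps power2_eq_square)
  also have "\<dots> = (\<Sum>j\<in>{1..k}. bit_var \<rho> p j * (d j)\<^sup>2) - g * (\<Sum>j\<in>{1..k}. pmf p j * d j)\<^sup>2"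
    by (simp only: power2_eq_square[of "sum _ _"] sum_product)
       (simp add: sum_subtractf sum_distrib_left)
  also have "\<dots> \<le> (\<Sum>j\<in>{1..k}. bit_var \<rho> p j * (d j)\<^sup>2)" using g by simp
  also have "\<dots> \<le> (\<Sum>j\<in>{1..k}. 1 * (d j)\<^sup>2)"
    by (intro sum_mono mult_right_mono bit_var_bounds) simp
  finally show ?thesis by simp
qed

text \<open>Cauchy-Schwarz on the L1 distance, which exceeds 2\<epsilon> because total variation is
  half of it; hence the factor 4.\<close>

lemma sum_bit_mean_sq_ge:
  assumes k: "1 \<le> k" and "0 < \<epsilon>" "\<epsilon> < tv_dist k p q"
  shows "4 * (gap \<rho>)\<^sup>2 * \<epsilon>\<^sup>2 / k \<le> (\<Sum>j\<in>{1..k}. (bit_mean \<rho> q p j)\<^sup>2)"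
proof -
  let ?L = "\<Sum>x\<in>{1..k}. \<bar>pmf p x - pmf q x\<bar>"
  have "(2 * \<epsilon>)\<^sup>2 \<le> ?L\<^sup>2"
    using assms by (intro power_mono) (auto simp: tv_dist_def)
  also have "\<dots> \<le> (\<Sum>x\<in>{1..k}. \<bar>pmf p x - pmf q x\<bar>\<^sup>2) * card {1..k}"
    by (rule sum_squared_le_sum_of_squares)
  finally have "4 * \<epsilon>\<^sup>2 / k \<le> (\<Sum>x\<in>{1..k}. (pmf p x - pmf q x)\<^sup>2)"
    using k by (simp add: field_simps)
  from mult_left_mono[OF this, of "(gap \<rho>)\<^sup>2"]
  show ?thesis by (simp add: bit_mean_def power_mult_distrib sum_distrib_left mult_ac)
qed

section \<open>Error probability of a single pair of blocks\<close>

text \<open>With X = m D the Chebyshev ratio becomes (16 k + 8 X) / X^2, and X is at least both 256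
  and 256 sqrt k.\<close>

lemma deviation_bound_le:
  fixes m k D :: real
  assumes "0 < m" "1 \<le> k" "256 * sqrt k \<le> m * D"
  shows "(m\<^sup>2 * (4 * k) + 2 * m ^ 3 * D) / (m\<^sup>2 * D / 2)\<^sup>2 \<le> 1 / 16"
proof -
  define X where "X = m * D"
  have "256 * 1 \<le> 256 * sqrt k" using assms by simp
  then have X: "256 \<le> X" "256 * sqrt k \<le> X" using assms unfolding X_def by linarith+
  have "(256 * sqrt k)\<^sup>2 \<le> X\<^sup>2" using X assms by (intro power_mono) auto
  then have "65536 * k \<le> X\<^sup>2" using assms by (simp add: power_mult_distrib)
  moreover have "256 * X \<le> X\<^sup>2" using X by (simp add: power2_eq_square)
  \<comment> \<open>Replacing X^2 by a variable leaves a linear problem: 256 k is at most Y/256 and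
    128 X at most Y/2.\<close>
  moreover have "16 * (16 * k + 8 * X) \<le> Y" if "65536 * k \<le> Y" "256 * X \<le> Y" for Y
    using that X by argo
  ultimately have num: "16 * (16 * k + 8 * X) \<le> X\<^sup>2" by blast
  have "(m\<^sup>2 * (4 * k) + 2 * m ^ 3 * D) / (m\<^sup>2 * D / 2)\<^sup>2 = (m\<^sup>2 * (16 * k + 8 * X)) / (m\<^sup>2 * X\<^sup>2)"
    by (simp add: X_def power2_eq_square power3_eq_cube field_simps)
  also have "\<dots> = (16 * k + 8 * X) / X\<^sup>2" using assms by simp
  also have "\<dots> \<le> 1 / 16" using num X by (simp add: field_simps)
  finally show ?thesis .
qed

definition min_signal :: "nat \<Rightarrow> real \<Rightarrow> real \<Rightarrow> real" where
  "min_signal k \<rho> \<epsilon> = 4 * (gap \<rho>)\<^sup>2 * \<epsilon>\<^sup>2 / real k"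

text \<open>Halfway between the mean 0 under \<open>q\<close> and the lower bound on the mean under
  an \<epsilon>-far distribution.\<close>

definition threshold :: "nat \<Rightarrow> real \<Rightarrow> real \<Rightarrow> nat \<Rightarrow> real" where
  "threshold k \<rho> \<epsilon> m = (real m)\<^sup>2 * min_signal k \<rho> \<epsilon> / 2"

context
  fixes k m :: nat and \<rho> \<epsilon> :: real and q :: "nat pmf" and I A B :: "nat set"
  assumes k: "1 \<le> k" and m: "0 < m"
    and size: "256 * sqrt (real k) \<le> real m * min_signal k \<rho> \<epsilon>"
    and q: "q \<in> distributions_on k" and \<epsilon>: "0 < \<epsilon>"
    and blocks: "finite I" "A \<subseteq> I" "B \<subseteq> I" "A \<inter> B = {}" "card A = m" "card B = m"
begin

lemma split_sample_rappor:
  assumes "p' \<in> distributions_on k"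
  shows "split_sample I A B m (message k \<rho> p') {1..k} (centred_bit \<rho> q) (bit_mean \<rho> q p') (bit_cov \<rho> p')"
  using assms blocks
  by unfold_locales (auto simp: finite_set_message expectation_centred_bit expectation_centred_bit_mult
      simp del: atLeastAtMost_iff)

lemma min_signal_pos: "0 < min_signal k \<rho> \<epsilon>"
proof -
  have "0 < 256 * sqrt (real k)" using k by simp
  also note size
  finally show ?thesis using m by (simp only: zero_less_mult_iff of_nat_0_less_iff) auto
qed

lemma block_false_reject_prob:
  "measure_pmf.prob (Pi_pmf I d (\<lambda>_. message k \<rho> q))
     {x. threshold k \<rho> \<epsilon> m \<le> split_stat (centred_bit \<rho> q) {1..k} A B x} \<le> 1 / 16"
proof -
  interpret split_sample I A B m d "message k \<rho> q" "{1..k}" "centred_bit \<rho> q" "bit_mean \<rho> q q" "bit_cov \<rho> q"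
    by (rule split_sample_rappor[OF q])
  have "measure_pmf.prob P {x. threshold k \<rho> \<epsilon> m \<le> stat x} \<le>
        measure_pmf.prob P {x. (real m)\<^sup>2 * min_signal k \<rho> \<epsilon> / 2 \<le> \<bar>stat x - (real m)\<^sup>2 * (\<Sum>j\<in>{1..k}. (bit_mean \<rho> q q j)\<^sup>2)\<bar>}"
    by (intro measure_pmf.finite_measure_mono) (auto simp: bit_mean_def threshold_def)
  \<comment> \<open>The quadratic form vanishes under \<open>q\<close>; bounding it by
    \<open>min_signal\<close> instead gives the ratio the shape that
    \<open>deviation_bound_le\<close> expects.\<close>
  also have "\<dots> \<le> ((real m)\<^sup>2 * (4 * real k) + 2 * real m ^ 3 * min_signal k \<rho> \<epsilon>) / ((real m)\<^sup>2 * min_signal k \<rho> \<epsilon> / 2)\<^sup>2"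
    by (rule stat_deviation_prob)
       (use min_signal_pos m sum_bit_cov_sq_le[OF q k, of \<rho>] in \<open>auto simp: bit_mean_def\<close>)
  also have "\<dots> \<le> 1 / 16" by (rule deviation_bound_le) (use m k size in auto)
  finally show ?thesis .
qed

text \<open>The variance grows with the actual signal \<open>?D\<close>, which may far exceed
  \<open>min_signal\<close>. The deviation is therefore measured as half the actual mean, and
  staying below the threshold forces a deviation at least that large.\<close>

lemma block_false_accept_prob:
  assumes p: "p \<in> distributions_on k" and tv: "\<epsilon> < tv_dist k p q"
  shows "measure_pmf.prob (Pi_pmf I d (\<lambda>_. message k \<rho> p))
     {x. \<not> threshold k \<rho> \<epsilon> m \<le> split_stat (centred_bit \<rho> q) {1..k} A B x} \<le> 1 / 16"
proof -
  interpret split_sample I A B m d "message k \<rho> p" "{1..k}" "centred_bit \<rho> q" "bit_mean \<rho> q p" "bit_cov \<rho> p"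
    by (rule split_sample_rappor[OF p])
  let ?D = "\<Sum>j\<in>{1..k}. (bit_mean \<rho> q p j)\<^sup>2"
  have D: "min_signal k \<rho> \<epsilon> \<le> ?D" unfolding min_signal_def by (rule sum_bit_mean_sq_ge[OF k \<epsilon> tv])
  have mD: "(real m)\<^sup>2 * min_signal k \<rho> \<epsilon> \<le> (real m)\<^sup>2 * ?D" by (rule mult_left_mono[OF D]) simp
  have "measure_pmf.prob P {x. \<not> threshold k \<rho> \<epsilon> m \<le> stat x} \<le>
        measure_pmf.prob P {x. (real m)\<^sup>2 * ?D / 2 \<le> \<bar>stat x - (real m)\<^sup>2 * ?D\<bar>}"
  proof (rule measure_pmf.finite_measure_mono; clarify?)
    have half: "b / 2 \<le> \<bar>s - b\<bar>" if "\<not> a / 2 \<le> s" "a \<le> b" "0 \<le> b" for a b s :: real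
      using that by linarith
    fix x assume "\<not> threshold k \<rho> \<epsilon> m \<le> stat x"
    from half[OF this[unfolded threshold_def] mD]
    show "(real m)\<^sup>2 * ?D / 2 \<le> \<bar>stat x - (real m)\<^sup>2 * ?D\<bar>" by (simp add: sum_nonneg)
  qed simp
  also have "\<dots> \<le> ((real m)\<^sup>2 * (4 * real k) + 2 * real m ^ 3 * ?D) / ((real m)\<^sup>2 * ?D / 2)\<^sup>2"
  proof (rule stat_deviation_prob)
    show "0 < (real m)\<^sup>2 * ?D / 2" using min_signal_pos D m by simp
  qed (use sum_bit_cov_sq_le[OF p k, of \<rho>] sum_bit_cov_quadratic_form_le in auto)
  also have "\<dots> \<le> 1 / 16"
  proof (rule deviation_bound_le)
    show "256 * sqrt (real k) \<le> real m * ?D"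
      using size mult_left_mono[OF D, of m] by linarith
  qed (use m k in auto)
  finally show ?thesis .
qed

end

section \<open>The protocol and its referee\<close>

text \<open>The coin is constant: all player randomness sits inside the RAPPOR channel.\<close>

definition rappor_protocol ::
    "nat \<Rightarrow> real \<Rightarrow> ((nat \<Rightarrow> nat \<Rightarrow> bool) \<Rightarrow> bool pmf) \<Rightarrow> (nat, nat \<Rightarrow> bool) protocol" where
  "rappor_protocol k \<rho> R = \<lparr>coin = (\<lambda>_. return_pmf 0), chan = (\<lambda>_ _. rappor k \<rho>), referee = R\<rparr>"

lemma ldp_rappor_protocol: "0 < \<rho> \<Longrightarrow> ldp_protocol n k \<rho> (rappor_protocol k \<rho> R)"
  using locally_private_rappor[of \<rho> k] by (simp add: ldp_protocol_def rappor_protocol_def)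

lemma all_use_rappor_protocol: "all_use_rappor n k \<rho> (rappor_protocol k \<rho> R)"
  by (simp add: all_use_rappor_def rappor_protocol_def)

text \<open>Products commute with coordinatewise bind, so the referee sees i.i.d. messages.\<close>

lemma outcome_rappor_protocol:
  "outcome n (rappor_protocol k \<rho> R) p =
     bind_pmf (Pi_pmf {1..n} undefined (\<lambda>_. message k \<rho> p)) R"
  unfolding outcome_def rappor_protocol_def message_def
  by (subst Pi_pmf_bind[where d' = undefined]) (simp_all add: bind_return_pmf bind_assoc_pmf)

lemma pmf_bind_return_bool:
  "pmf (bind_pmf N (\<lambda>y. return_pmf (b y))) True = 1 - measure_pmf.prob N {y. \<not> b y}"
  "pmf (bind_pmf N (\<lambda>y. return_pmf (b y))) False = 1 - measure_pmf.prob N {y. b y}"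
proof -
  have "pmf (bind_pmf N (\<lambda>y. return_pmf (b y))) c = measure_pmf.prob N {y. b y = c}" for c
    by (simp add: map_pmf_def[symmetric] pmf_map vimage_def)
  moreover have "measure_pmf.prob N {y. \<not> b y} = 1 - measure_pmf.prob N {y. b y}"
    using measure_pmf.prob_compl[of "{y. b y}" N] by (simp add: Compl_eq Compl_eq_Diff_UNIV[symmetric])
  ultimately show
    "pmf (bind_pmf N (\<lambda>y. return_pmf (b y))) True = 1 - measure_pmf.prob N {y. \<not> b y}"
    "pmf (bind_pmf N (\<lambda>y. return_pmf (b y))) False = 1 - measure_pmf.prob N {y. b y}"
    by simp_all
qed

text \<open>Left-open intervals fit the numbering of players from 1; block pair \<open>s\<close>
  occupies \<open>2 * m\<close> consecutive players.\<close>

definition first_half :: "nat \<Rightarrow> nat \<Rightarrow> nat set" where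
  "first_half m s = {2 * m * s<..2 * m * s + m}"

definition second_half :: "nat \<Rightarrow> nat \<Rightarrow> nat set" where
  "second_half m s = {2 * m * s + m<..2 * m * Suc s}"

lemma halves_Un: "first_half m s \<union> second_half m s = {2 * m * s<..2 * m * Suc s}"
  by (auto simp: first_half_def second_half_def)

lemma disjoint_family_blocks:
  "disjoint_family_on (\<lambda>s. first_half m s \<union> second_half m s) {..<r}"
proof -
  have "{2 * m * s<..2 * m * Suc s} \<inter> {2 * m * t<..2 * m * Suc t} = {}" if "s < t" for s t
  proof -
    have "2 * m * Suc s \<le> 2 * m * t" using that by (intro mult_le_mono) auto
    then show ?thesis by auto
  qed
  then show ?thesis
    unfolding disjoint_family_on_def halves_Un by (metis Int_commute nat_neq_iff)
qed

lemma block_subset: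
  assumes "s < r" "2 * m * r \<le> n"
  shows "first_half m s \<union> second_half m s \<subseteq> {1..n}"
proof -
  have "2 * m * Suc s \<le> 2 * m * r" using assms by (intro mult_le_mono) auto
  then show ?thesis unfolding halves_Un using assms by auto
qed

definition block_rejects :: "nat \<Rightarrow> real \<Rightarrow> real \<Rightarrow> nat pmf \<Rightarrow> nat \<Rightarrow> nat \<Rightarrow> (nat \<Rightarrow> nat \<Rightarrow> bool) \<Rightarrow> bool" where
  "block_rejects k \<rho> \<epsilon> q m s y \<longleftrightarrow>
     threshold k \<rho> \<epsilon> m \<le> split_stat (centred_bit \<rho> q) {1..k} (first_half m s) (second_half m s) y"

text \<open>A tie rejects. This is covered by \<open>majority_failure_prob\<close>, whose event
  already includes failure of exactly half the tests.\<close>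

definition majority_referee ::
    "nat \<Rightarrow> real \<Rightarrow> real \<Rightarrow> nat pmf \<Rightarrow> nat \<Rightarrow> nat \<Rightarrow> (nat \<Rightarrow> nat \<Rightarrow> bool) \<Rightarrow> bool pmf" where
  "majority_referee k \<rho> \<epsilon> q m r y =
     return_pmf (2 * card {s. s < r \<and> block_rejects k \<rho> \<epsilon> q m s y} < r)"

lemma majority_referee_solves:
  assumes k: "1 \<le> k" and m: "0 < m" and r: "0 < r"
    and size: "256 * sqrt (real k) \<le> real m * min_signal k \<rho> \<epsilon>"
    and q: "q \<in> distributions_on k" and \<epsilon>: "0 < \<epsilon>"
    and n: "2 * m * r \<le> n" and \<delta>: "(1 / 2) ^ r \<le> \<delta>"
  shows "solves_identity_testing n k \<epsilon> \<delta> q (rappor_protocol k \<rho> (majority_referee k \<rho> \<epsilon> q m r))"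
proof -
  let ?N = "\<lambda>p. Pi_pmf {1..n} undefined (\<lambda>_. message k \<rho> p)"
  let ?rej = "block_rejects k \<rho> \<epsilon> q m"
  have halves: "first_half m s \<subseteq> {1..n}" "second_half m s \<subseteq> {1..n}"
    "first_half m s \<inter> second_half m s = {}" "card (first_half m s) = m" "card (second_half m s) = m"
    if "s < r" for s
    using block_subset[OF that n] by (auto simp: first_half_def second_half_def)
  have det: "determined_by (first_half m s \<union> second_half m s) (?rej s)" for s
    using determined_by_split_stat[of "first_half m s" "second_half m s" "centred_bit \<rho> q" "{1..k}"]
    unfolding determined_by_def block_rejects_def by metis
  then have det': "determined_by (first_half m s \<union> second_half m s) (\<lambda>y. \<not> ?rej s y)" for s
    unfolding determined_by_def by metis
  \<comment> \<open>One bound serves both errors: \<open>F\<close> is rejection by a block under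
    \<open>q\<close>, and its negation under a far \<open>p\<close>.\<close>
  have majority: "measure_pmf.prob (?N p) {y. r \<le> 2 * card {s. s < r \<and> F s y}} < \<delta>"
    if "p \<in> distributions_on k"
      and "\<And>s. determined_by (first_half m s \<union> second_half m s) (F s)"
      and "\<And>s. s < r \<Longrightarrow> measure_pmf.prob (?N p) {y. F s y} \<le> 1 / 16" for p F
    using majority_failure_prob[where F = F and I = "{1..n}" and M = "\<lambda>_. message k \<rho> p" and r = r
        and d = undefined, OF _ block_subset[OF _ n] disjoint_family_blocks] that r \<delta> finite_set_message
    by fastforce
  have "measure_pmf.prob (?N q) {y. r \<le> 2 * card {s. s < r \<and> ?rej s y}} < \<delta>"
  proof (rule majority[OF q det])
    show "measure_pmf.prob (?N q) {y. ?rej s y} \<le> 1 / 16" if "s < r" for s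
      unfolding block_rejects_def
      by (rule block_false_reject_prob) (use k m size q \<epsilon> halves[OF that] in auto)
  qed
  then have accept: "pmf (outcome n (rappor_protocol k \<rho> (majority_referee k \<rho> \<epsilon> q m r)) q) True > 1 - \<delta>"
    by (simp add: outcome_rappor_protocol majority_referee_def[abs_def] pmf_bind_return_bool not_less)
  have "pmf (outcome n (rappor_protocol k \<rho> (majority_referee k \<rho> \<epsilon> q m r)) p) False > 1 - \<delta>"
    if p: "p \<in> distributions_on k" and tv: "tv_dist k p q > \<epsilon>" for p
  proof -
    have split: "card {s. s < r \<and> ?rej s y} + card {s. s < r \<and> \<not> ?rej s y} = r" for y
    proof -
      have "card {s. s < r \<and> ?rej s y} + card {s. s < r \<and> \<not> ?rej s y} =
            card ({s. s < r \<and> ?rej s y} \<union> {s. s < r \<and> \<not> ?rej s y})"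
        by (rule card_Un_disjoint[symmetric]) auto
      also have "{s. s < r \<and> ?rej s y} \<union> {s. s < r \<and> \<not> ?rej s y} = {..<r}" by auto
      finally show ?thesis by simp
    qed
    have "r \<le> 2 * card {s. s < r \<and> \<not> ?rej s y}" if "2 * card {s. s < r \<and> ?rej s y} < r" for y
      using split[of y] that by linarith
    then have "measure_pmf.prob (?N p) {y. 2 * card {s. s < r \<and> ?rej s y} < r} \<le>
          measure_pmf.prob (?N p) {y. r \<le> 2 * card {s. s < r \<and> \<not> ?rej s y}}"
      by (intro measure_pmf.finite_measure_mono) auto
    also have "\<dots> < \<delta>"
    proof (rule majority[OF p det'])
      show "measure_pmf.prob (?N p) {y. \<not> ?rej s y} \<le> 1 / 16" if "s < r" for s
        unfolding block_rejects_def
        by (rule block_false_accept_prob) (use k m size q p tv \<epsilon> halves[OF that] in auto)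
    qed
    finally show ?thesis
      by (simp add: outcome_rappor_protocol majority_referee_def[abs_def] pmf_bind_return_bool)
  qed
  with accept show ?thesis unfolding solves_identity_testing_def by blast
qed

text \<open>Each verdict has probability 1/2 > 1 - \<delta> whatever the messages are, so any number
  of players will do.\<close>

lemma coin_flip_solves:
  assumes "1 / 2 < \<delta>"
  shows "solves_identity_testing n k \<epsilon> \<delta> q (rappor_protocol k \<rho> (\<lambda>_. bernoulli_pmf (1 / 2)))"
  using assms by (simp add: solves_identity_testing_def outcome_rappor_protocol)

section \<open>Choice of constants\<close>

text \<open>Lets the rounding of the block size to an integer be absorbed into the constant.\<close>

lemma sample_size_ge_1:
  assumes "1 \<le> k" "0 < \<rho>" "\<rho> \<le> 1" "0 < \<epsilon>" "\<epsilon> \<le> 1"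
  shows "1 \<le> real k powr (3 / 2) / (\<epsilon>\<^sup>2 * \<rho>\<^sup>2)"
proof -
  have "\<epsilon>\<^sup>2 * \<rho>\<^sup>2 \<le> 1" using assms by (intro mult_le_one power_le_one) auto
  also have "1 \<le> real k powr (3 / 2)" using assms by (intro ge_one_powr_ge_zero) auto
  finally show ?thesis using assms by (simp add: pos_le_divide_eq)
qed

text \<open>Since the gap is at least \<rho>/6, the signal is at least \<rho>^2 \<epsilon>^2 / (9
  k); the constant is 2304 = 9 * 256.\<close>

lemma block_size_suffices:
  assumes "1 \<le> k" "0 < \<rho>" "\<rho> \<le> 1" "0 < \<epsilon>"
    and m: "2304 * (real k powr (3 / 2) / (\<epsilon>\<^sup>2 * \<rho>\<^sup>2)) \<le> real m"
  shows "256 * sqrt (real k) \<le> real m * min_signal k \<rho> \<epsilon>"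
proof -
  have powr: "real k powr (3 / 2) = real k * sqrt (real k)"
  proof -
    have "real k powr (3 / 2) = real k powr (1 + 1 / 2)" by simp
    also have "\<dots> = real k powr 1 * real k powr (1 / 2)" by (rule powr_add)
    finally show ?thesis using assms by (simp add: powr_half_sqrt)
  qed
  have "256 * sqrt (real k) =
        2304 * (real k powr (3 / 2) / (\<epsilon>\<^sup>2 * \<rho>\<^sup>2)) * (4 * (\<rho> / 6)\<^sup>2 * \<epsilon>\<^sup>2 / real k)"
    using assms by (simp add: powr power_divide)
  also have "\<dots> \<le> real m * min_signal k \<rho> \<epsilon>"
    unfolding min_signal_def
    using assms gap_ge[of \<rho>] by (intro mult_mono m divide_right_mono mult_left_mono mult_right_mono power_mono) auto
  finally show ?thesis .
qed

theorem theorem1: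
  "\<exists>C::real. C > 0 \<and>
     (\<forall>(k::nat) (\<rho>::real) (\<epsilon>::real) (\<delta>::real) (q::nat pmf).
        k \<ge> 1 \<and> 0 < \<rho> \<and> \<rho> \<le> 1 \<and> 0 < \<epsilon> \<and> \<epsilon> \<le> 1 \<and> 0 < \<delta> \<and> \<delta> < 1 \<and> q \<in> distributions_on k \<longrightarrow>
        (\<forall>n::nat. n = nat \<lceil>C * (real k powr (3 / 2) / (\<epsilon>\<^sup>2 * \<rho>\<^sup>2)) * ln (1 / \<delta>)\<rceil> \<longrightarrow>
           (\<exists>P :: (nat, nat \<Rightarrow> bool) protocol.
              ldp_protocol n k \<rho> P \<and> all_use_rappor n k \<rho> P \<and>
              solves_identity_testing n k \<epsilon> \<delta> q P)))"
\<comment> \<open>9220 = 2 * 2305 * 2: two halves per test, at most 2305 K players in each half, and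
  at most 2 L tests. The division by ln 2 turns ln into the binary logarithm L.\<close>
proof (intro exI[of _ "9220 / ln 2"] conjI allI impI)
  show "0 < 9220 / ln (2::real)" by simp
next
  fix k n :: nat and \<rho> \<epsilon> \<delta> :: real and q :: "nat pmf"
  assume asm: "k \<ge> 1 \<and> 0 < \<rho> \<and> \<rho> \<le> 1 \<and> 0 < \<epsilon> \<and> \<epsilon> \<le> 1 \<and> 0 < \<delta> \<and> \<delta> < 1 \<and> q \<in> distributions_on k"
    and n: "n = nat \<lceil>9220 / ln 2 * (real k powr (3 / 2) / (\<epsilon>\<^sup>2 * \<rho>\<^sup>2)) * ln (1 / \<delta>)\<rceil>"
  define K where "K = real k powr (3 / 2) / (\<epsilon>\<^sup>2 * \<rho>\<^sup>2)"
  have "\<exists>R. solves_identity_testing n k \<epsilon> \<delta> q (rappor_protocol k \<rho> R)"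
  proof (cases "1 / 2 < \<delta>")
    case True
    then show ?thesis using coin_flip_solves by blast
  next
    case False
    define L where "L = ln (1 / \<delta>) / ln 2"
    define m where "m = nat \<lceil>2304 * K\<rceil>"
    define r where "r = nat \<lceil>L\<rceil>"
    have K: "1 \<le> K" unfolding K_def using asm by (intro sample_size_ge_1) auto
    have "ln 2 \<le> ln (1 / \<delta>)" using False asm by (subst ln_le_cancel_iff) (auto simp: field_simps)
    then have L: "1 \<le> L" by (simp add: L_def)
    have m: "2304 * K \<le> real m" "real m \<le> 2305 * K" using K unfolding m_def by linarith+
    \<comment> \<open>As \<delta> \<le> 1/2 gives L \<ge> 1, rounding up at most doubles L.\<close>
    have r: "L \<le> real r" "real r \<le> 2 * L" using L unfolding r_def by linarith+
    have "(1 / 2) ^ r = 2 powr - real r"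
      by (simp add: powr_minus powr_realpow power_one_over inverse_eq_divide)
    also have "\<dots> \<le> 2 powr - L" using r by simp
    also have "\<dots> = \<delta>" using asm by (simp add: L_def powr_def ln_div)
    finally have \<delta>: "(1 / 2) ^ r \<le> \<delta>" .
    have "real m * real r \<le> 2305 * K * (2 * L)" using m r K L by (intro mult_mono) auto
    then have "real (2 * m * r) \<le> 9220 / ln 2 * K * ln (1 / \<delta>)" by (simp add: L_def)
    also have "\<dots> \<le> real n" unfolding n K_def[symmetric] by (rule real_nat_ceiling_ge)
    \<comment> \<open>Players beyond the first \<open>2 * m * r\<close> also send messages, which
      the referee ignores.\<close>
    finally have "2 * m * r \<le> n" by (simp only: of_nat_le_iff)
    moreover have "256 * sqrt (real k) \<le> real m * min_signal k \<rho> \<epsilon>"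
      using asm m(1) unfolding K_def by (intro block_size_suffices) auto
    moreover have "0 < m" "0 < r" using m r K L by (auto intro!: Nat.gr0I)
    ultimately show ?thesis using asm \<delta> majority_referee_solves by blast
  qed
  then show "\<exists>P :: (nat, nat \<Rightarrow> bool) protocol. ldp_protocol n k \<rho> P \<and> all_use_rappor n k \<rho> P \<and>
      solves_identity_testing n k \<epsilon> \<delta> q P"
    using asm ldp_rappor_protocol all_use_rappor_protocol by blast
qed

end
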